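(* Let $d$ and $T>4$ be non-negative integers and let $\epsilon>0$. 1. Let $L\ge8$ be an integer with $L\le dT$. There exists an input stream $x$ of $d$-dimensional vectors from $\{-1,0,1\}^d$, valid in the ``likes''-model with multiple updates per time step, of length $T$ and total flippancy $K$ with $\min(3L/8,T/4-1)\le K\le\min(L,dT/4)$, such that any item-level $\epsilon$-differentially private algorithm for the \textsc{CountDistinct} problem with error at most $\alpha$ at all time steps with probability at least $2/3$ must satisfy $$\alpha=\Omega\left(\min\left(d,L,\epsilon^{-1}T,\sqrt{\epsilon^{-1}L\max(\ln(T/L),1)}\right)\right)=\Omega\left(\min\left(d,K,\epsilon^{-1}T,\sqrt{\epsilon^{-1}K\max(\ln(T/K),1)}\right)\right).$$ 2. Let $L\ge8$ be an integer with $L\le T$. There exists an input stream $x$ of $d$-dimensional vectors from $\{-1,0,1\}^d$, valid in the ``likes''-model, of length $T$, with total flippancy $K$ satisfying $L/16\le K\le\min(L,T/4)$, and with $\|x^t\|_1=1$ for all $t$ (each update modifies at most one item), such that any item-level $\epsilon$-differentially private algorithm for the \textsc{CountDistinct} problem with error at most $\alpha$ at all time steps with probability at least $2/3$ must satisfy $$\alpha=\Omega\left(\min\left(d,K,\sqrt{\epsilon^{-1}K\ln(T/K)}\right)\right).$$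
   Context: An input stream of length $T$ is $x=(x^1,\dots,x^T)$ with $x^t\in\{-1,0,1\}^d$. For item $i$, $f^t(x_i)=1$ if $\sum_{t'\le t}x_i^{t'}>0$ and $0$ otherwise; $\textsc{CountDistinct}(x)^t=\sum_i f^t(x_i)$. The \textsc{CountDistinct} problem asks a continual-observation algorithm to output at each time $t$ (using only $x^1,\dots,x^t$) an estimate of $\textsc{CountDistinct}(x)^t$; the error is the maximum absolute deviation over time steps. The total flippancy is $K=\sum_{i=1}^d\sum_{t=2}^T\mathbb{1}(f^t(x_i)\ne f^{t-1}(x_i))$. A stream is valid in the ``likes''-model if $\sum_{t'\le t}x_i^{t'}\in\{0,1\}$ for all $i,t$. Streams $x,y$ are item-level neighboring if there is an item $i^*$ with $x_i^t=y_i^t$ for all $t$ and $i\ne i^*$. An algorithm $A$ with output sequence $A^T(x)$ is item-level $\epsilon$-differentially private if for all item-level neighboring $x,y$ and all sets $S$ of output sequences, $\Pr[A^T(x)\in S]\le e^\epsilon\Pr[A^T(y)\in S]$.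
   Formalization: Part 2 uses ‖x^t‖_1 ≤ 1 instead of = 1 (equality forces K = T−1 > T/4) and assumes d ≥ 1 (d = 0 forces K = 0 < L/16); Ω means α ≥ c·g once the bound g exceeds a universal constant (false otherwise for huge ε); error ≤ α is required on all streams sharing x's K and type. *)

theory Defs
  imports "HOL-Probability.Probability"
begin

text \<open>A stream is a function of the time step \<open>t \<in> {1..T}\<close> and the item \<open>i \<in> {1..d}\<close>.
  Entries outside these ranges are fixed to 0, so that an algorithm, which is a function of the
  stream, has access only to the actual entries.\<close>

type_synonym stream = "nat \<Rightarrow> nat \<Rightarrow> int"

definition input_streams :: "nat \<Rightarrow> nat \<Rightarrow> stream set" where
  "input_streams d T =
     {x. (\<forall>t i. x t i \<in> {-1, 0, 1}) \<and>
         (\<forall>t i. t \<notin> {1..T} \<or> i \<notin> {1..d} \<longrightarrow> x t i = 0)}"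

definition present :: "stream \<Rightarrow> nat \<Rightarrow> nat \<Rightarrow> nat" where
  "present x t i = (if (\<Sum>s=1..t. x s i) > 0 then 1 else 0)"

definition count_distinct :: "nat \<Rightarrow> stream \<Rightarrow> nat \<Rightarrow> nat" where
  "count_distinct d x t = (\<Sum>i=1..d. present x t i)"

definition total_flippancy :: "nat \<Rightarrow> nat \<Rightarrow> stream \<Rightarrow> nat" where
  "total_flippancy d T x =
     (\<Sum>i=1..d. \<Sum>t=2..T. of_bool (present x t i \<noteq> present x (t - 1) i))"

definition likes_valid :: "nat \<Rightarrow> nat \<Rightarrow> stream \<Rightarrow> bool" where
  "likes_valid d T x \<longleftrightarrow> (\<forall>i\<in>{1..d}. \<forall>t\<in>{1..T}. (\<Sum>s=1..t. x s i) \<in> {0, 1})"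

text \<open>The norm is bounded by 1, not equal to 1: in the likes model every nonzero entry flips an
  item, so norm exactly 1 at every step would force flippancy \<open>T - 1\<close>.\<close>

definition single_update :: "nat \<Rightarrow> nat \<Rightarrow> stream \<Rightarrow> bool" where
  "single_update d T x \<longleftrightarrow> (\<forall>t\<in>{1..T}. (\<Sum>i=1..d. \<bar>x t i\<bar>) \<le> 1)"

definition item_neighboring :: "nat \<Rightarrow> nat \<Rightarrow> stream \<Rightarrow> stream \<Rightarrow> bool" where
  "item_neighboring d T x y \<longleftrightarrow>
     (\<exists>j\<in>{1..d}. \<forall>t\<in>{1..T}. \<forall>i\<in>{1..d}. i \<noteq> j \<longrightarrow> x t i = y t i)"

definition output_space :: "nat \<Rightarrow> (nat \<Rightarrow> real) measure" where
  "output_space T = (\<Pi>\<^sub>M t\<in>{1..T}. borel)"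

text \<open>A randomized algorithm is given by the law of its output sequence on each stream. That the
  output at time \<open>t\<close> is computed from the first \<open>t\<close> inputs means that the joint law of the first
  \<open>t\<close> outputs is the same for any two streams that agree up to time \<open>t\<close>.\<close>

definition continual_algorithm :: "nat \<Rightarrow> nat \<Rightarrow> (stream \<Rightarrow> (nat \<Rightarrow> real) measure) \<Rightarrow> bool" where
  "continual_algorithm d T A \<longleftrightarrow>
     (\<forall>x\<in>input_streams d T. prob_space (A x) \<and> sets (A x) = sets (output_space T)) \<and>
     (\<forall>x\<in>input_streams d T. \<forall>y\<in>input_streams d T. \<forall>t\<in>{1..T}.
        (\<forall>s\<in>{1..t}. x s = y s) \<longrightarrow>
        distr (A x) (output_space t) (\<lambda>out. restrict out {1..t}) =
        distr (A y) (output_space t) (\<lambda>out. restrict out {1..t}))"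

definition item_level_dp ::
  "nat \<Rightarrow> nat \<Rightarrow> real \<Rightarrow> (stream \<Rightarrow> (nat \<Rightarrow> real) measure) \<Rightarrow> bool" where
  "item_level_dp d T \<epsilon> A \<longleftrightarrow>
     (\<forall>x\<in>input_streams d T. \<forall>y\<in>input_streams d T. item_neighboring d T x y \<longrightarrow>
        (\<forall>S\<in>sets (output_space T). measure (A x) S \<le> exp \<epsilon> * measure (A y) S))"

definition max_error :: "nat \<Rightarrow> nat \<Rightarrow> stream \<Rightarrow> (nat \<Rightarrow> real) \<Rightarrow> real" where
  "max_error d T x out = (MAX t\<in>{1..T}. \<bar>out t - real (count_distinct d x t)\<bar>)"

definition accurate_on ::
  "nat \<Rightarrow> nat \<Rightarrow> real \<Rightarrow> stream set \<Rightarrow> (stream \<Rightarrow> (nat \<Rightarrow> real) measure) \<Rightarrow> bool" where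
  "accurate_on d T \<alpha> X A \<longleftrightarrow>
     (\<forall>x\<in>X. measure (A x) {out \<in> space (output_space T). max_error d T x out \<le> \<alpha>} \<ge> 2 / 3)"

text \<open>The inputs on which an algorithm has to be accurate: those of a given total flippancy.\<close>

definition likes_streams :: "nat \<Rightarrow> nat \<Rightarrow> nat \<Rightarrow> stream set" where
  "likes_streams d T K =
     {x \<in> input_streams d T. likes_valid d T x \<and> total_flippancy d T x = K}"

definition single_likes_streams :: "nat \<Rightarrow> nat \<Rightarrow> nat \<Rightarrow> stream set" where
  "single_likes_streams d T K = {x \<in> likes_streams d T K. single_update d T x}"

definition multi_bound :: "nat \<Rightarrow> nat \<Rightarrow> real \<Rightarrow> nat \<Rightarrow> real" where
  "multi_bound d T \<epsilon> k =
     Min {real d, real k, real T / \<epsilon>,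
          sqrt (real k / \<epsilon> * max (ln (real T / real k)) 1)}"

definition single_bound :: "nat \<Rightarrow> nat \<Rightarrow> real \<Rightarrow> nat \<Rightarrow> real" where
  "single_bound d T \<epsilon> k =
     Min {real d, real k, sqrt (real k / \<epsilon> * ln (real T / real k))}"

text \<open>\<open>\<alpha> = \<Omega>(g)\<close> with constants \<open>c\<close>, \<open>g0\<close> that must be universal; this is \<open>bigomega\<close> along the
  filter \<open>filtercomap g at_top\<close> on the parameters. The threshold \<open>g0\<close> is necessary: for \<open>\<epsilon>\<close> much larger
  than \<open>T * ln T\<close>, integer-valued noise gives error 0 with probability at least 2/3.\<close>

definition Omega_bound :: "real \<Rightarrow> real \<Rightarrow> real \<Rightarrow> real \<Rightarrow> bool" where
  "Omega_bound c g0 \<alpha> g \<longleftrightarrow> (g \<ge> g0 \<longrightarrow> \<alpha> \<ge> c * g)"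

end

theory Submission
  imports Defs
begin

text \<open>The bound comes from a packing. Fix \<open>k\<close> items and \<open>h\<close> disjoint blocks of time steps, and for every
  \<open>m\<close>-subset \<open>S\<close> of the blocks let all \<open>k\<close> items flip once in each block of \<open>S\<close>; flips after the last
  block fill the flippancy up to \<open>K\<close>. At the end of the first block where two such subsets differ, the
  two counts differ by \<open>k\<close>, so for \<open>\<alpha> < k / 2\<close> the sets of accurate outputs are disjoint. The streams
  differ in \<open>k\<close> items only, hence group privacy gives each of these sets probability at least
  \<open>2 / 3 * exp (- \<epsilon> * k)\<close> under one common law, and
  \<open>m * ln (h / m) \<le> ln (h choose m) = O(\<epsilon> * k)\<close>. Taking \<open>k\<close> a small multiple of the claimed bound and
  \<open>m\<close> about \<open>min (K / k) (T / 4)\<close> contradicts this. With several updates per step a block is one time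
  step; with single updates it consists of \<open>k\<close> steps.\<close>

section \<open>Streams with prescribed flips\<close>

text \<open>\<open>F\<close> holds the pairs of time and item at which presence is to change. The
  sign alternates with the number of earlier flips of the same item, so prefix sums stay in {0, 1}
  and the stream is valid in the likes model for every \<open>F\<close>.\<close>

definition flip_stream :: "(nat \<times> nat) set \<Rightarrow> stream" where
  "flip_stream F t i =
     (if (t, i) \<in> F then (-1) ^ card {s \<in> {1..<t}. (s, i) \<in> F} else 0)"

lemma sum_flip_stream:
  "(\<Sum>s=1..t. flip_stream F s i) = of_bool (odd (card {s \<in> {1..t}. (s, i) \<in> F}))"
proof (induction t)
  case 0
  then show ?case by simp
next
  case (Suc t)
  have "{s \<in> {1..Suc t}. (s, i) \<in> F} =
      (if (Suc t, i) \<in> F then insert (Suc t) {s \<in> {1..t}. (s, i) \<in> F}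
       else {s \<in> {1..t}. (s, i) \<in> F})"
    by (auto simp: le_Suc_eq)
  then show ?case
    using Suc by (simp add: flip_stream_def atLeastLessThanSuc_atLeastAtMost)
qed

lemma present_flip_stream:
  "present (flip_stream F) t i = of_bool (odd (card {s \<in> {1..t}. (s, i) \<in> F}))"
  unfolding present_def sum_flip_stream by simp

lemma present_flip_stream_changes_iff:
  assumes "1 \<le> t"
  shows "present (flip_stream F) t i \<noteq> present (flip_stream F) (t - 1) i \<longleftrightarrow> (t, i) \<in> F"
proof -
  obtain u where t: "t = Suc u" using assms by (cases t) auto
  have "{s \<in> {1..Suc u}. (s, i) \<in> F} =
      (if (Suc u, i) \<in> F then insert (Suc u) {s \<in> {1..u}. (s, i) \<in> F}
       else {s \<in> {1..u}. (s, i) \<in> F})"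
    by (auto simp: le_Suc_eq)
  then show ?thesis
    by (simp add: t present_flip_stream)
qed

text \<open>Each pair in \<open>F\<close> is one change of parity, hence one change of presence.
  Times start at 2 because flippancy compares \<open>t\<close> with \<open>t - 1\<close> from time 2
  on; a flip at time 1 would not be counted.\<close>

lemma total_flippancy_flip_stream:
  assumes "F \<subseteq> {2..T} \<times> {1..d}"
  shows "total_flippancy d T (flip_stream F) = card F"
proof -
  have "total_flippancy d T (flip_stream F) =
      (\<Sum>i=1..d. \<Sum>t=2..T. of_bool ((t, i) \<in> F))"
    unfolding total_flippancy_def
    by (intro sum.cong refl arg_cong[where f = of_bool] present_flip_stream_changes_iff) auto
  also have "\<dots> = (\<Sum>t=2..T. \<Sum>i=1..d. of_bool ((t, i) \<in> F))"
    by (rule sum.swap)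
  also have "\<dots> = (\<Sum>p\<in>{2..T} \<times> {1..d}. of_bool (p \<in> F))"
    by (simp only: sum.cartesian_product case_prod_unfold prod.collapse)
  also have "\<dots> = card F"
    using assms by (simp add: Int_absorb1 Int_absorb2 del: One_nat_def)
  finally show ?thesis .
qed

lemma flip_stream_in_input_streams:
  assumes "F \<subseteq> {1..T} \<times> {1..d}"
  shows "flip_stream F \<in> input_streams d T"
proof -
  have "flip_stream F t i \<in> {-1, 0, 1}" for t i
    by (cases "even (card {s \<in> {1..<t}. (s, i) \<in> F})") (auto simp: flip_stream_def)
  then show ?thesis
    using assms by (auto simp: input_streams_def flip_stream_def)
qed

lemma flip_stream_in_likes_streams:
  assumes "F \<subseteq> {2..T} \<times> {1..d}"
  shows "flip_stream F \<in> likes_streams d T (card F)"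
proof -
  have "F \<subseteq> {1..T} \<times> {1..d}" using assms by fastforce
  moreover have "likes_valid d T (flip_stream F)"
    unfolding likes_valid_def sum_flip_stream by simp
  ultimately show ?thesis
    using assms by (simp add: likes_streams_def total_flippancy_flip_stream
        flip_stream_in_input_streams)
qed

lemma single_update_flip_stream:
  assumes "\<And>t i i'. (t, i) \<in> F \<Longrightarrow> (t, i') \<in> F \<Longrightarrow> i = i'"
  shows "single_update d T (flip_stream F)"
  unfolding single_update_def
proof
  fix t
  let ?I = "{i \<in> {1..d}. (t, i) \<in> F}"
  have "(\<Sum>i=1..d. \<bar>flip_stream F t i\<bar>) = int (card ?I)"
    by (auto simp: flip_stream_def power_abs if_distrib[of abs] sum.If_cases Int_def cong: if_cong)
  moreover have "card ?I \<le> 1"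
    using assms by (auto simp: card_le_Suc0_iff_eq)
  ultimately show "(\<Sum>i=1..d. \<bar>flip_stream F t i\<bar>) \<le> 1"
    by simp
qed

section \<open>Group privacy and packing\<close>

lemma accurate_outputs_measurable:
  assumes "1 \<le> T"
  shows "{out \<in> space (output_space T). max_error d T x out \<le> \<alpha>} \<in> sets (output_space T)"
proof -
  have "{out \<in> space (output_space T). max_error d T x out \<le> \<alpha>} =
      {out \<in> space (output_space T). \<forall>t\<in>{1..T}. \<bar>out t - real (count_distinct d x t)\<bar> \<le> \<alpha>}"
    using assms by (auto simp: max_error_def)
  also have "\<dots> \<in> sets (output_space T)"
    unfolding output_space_def by measurable
  finally show ?thesis .
qed

text \<open>Hybrid argument: the hybrid \<open>z j\<close> takes items up to \<open>j\<close> from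
  \<open>y\<close> and the rest from \<open>x\<close>. Consecutive hybrids are neighbors, so each of
  the \<open>k\<close> replacements costs a factor \<open>exp \<epsilon>\<close>.\<close>

lemma item_level_dp_group:
  assumes dp: "item_level_dp d T \<epsilon> A"
    and x: "x \<in> input_streams d T" and y: "y \<in> input_streams d T"
    and eq: "\<And>t i. k < i \<Longrightarrow> x t i = y t i" and "k \<le> d"
    and S: "S \<in> sets (output_space T)"
  shows "measure (A x) S \<le> exp (\<epsilon> * real k) * measure (A y) S"
proof -
  define z where "z j = (\<lambda>t i. if i \<le> j then y t i else x t i)" for j
  have z: "z j \<in> input_streams d T" for j
    using x y by (auto simp: input_streams_def z_def)
  have "measure (A x) S \<le> exp (\<epsilon> * real j) * measure (A (z j)) S" if "j \<le> d" for j
    using that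
  proof (induction j)
    case 0
    \<comment> \<open>Index 0 is not an item: both streams vanish there, so replacing it changes
      nothing.\<close>
    have "x t 0 = 0" "y t 0 = 0" for t
      using x y by (auto simp: input_streams_def)
    then have "z 0 = x" by (auto simp: z_def fun_eq_iff)
    then show ?case by simp
  next
    case (Suc j)
    have "item_neighboring d T (z j) (z (Suc j))"
      unfolding item_neighboring_def
      using Suc.prems by (intro bexI[of _ "Suc j"]) (auto simp: z_def)
    then have "measure (A (z j)) S \<le> exp \<epsilon> * measure (A (z (Suc j))) S"
      using dp z S unfolding item_level_dp_def by blast
    then have "exp (\<epsilon> * real j) * measure (A (z j)) S \<le>
        exp (\<epsilon> * real j) * (exp \<epsilon> * measure (A (z (Suc j))) S)"
      by (intro mult_left_mono) auto
    with Suc have "measure (A x) S \<le> exp (\<epsilon> * real j) * (exp \<epsilon> * measure (A (z (Suc j))) S)"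
      by linarith
    then show ?case by (simp add: exp_add algebra_simps)
  qed
  moreover have "z k = y"
    using eq by (auto simp: z_def fun_eq_iff)
  ultimately show ?thesis using \<open>k \<le> d\<close> by blast
qed

text \<open>An output within \<open>\<alpha>\<close> of two counts would force them to lie within
  \<open>2 * \<alpha>\<close>, so the accurate sets \<open>G a\<close> are disjoint. By group
  privacy each has mass at least \<open>2 / 3 * exp (- \<epsilon> * k)\<close> under the law for one
  fixed stream \<open>Y b\<close>, and these masses sum to at most 1.\<close>

lemma packing_bound:
  assumes alg: "continual_algorithm d T A" and dp: "item_level_dp d T \<epsilon> A"
    and acc: "accurate_on d T \<alpha> X A"
    and I: "finite I" "Y ` I \<subseteq> X" "Y ` I \<subseteq> input_streams d T"
    and eq: "\<And>a b t i. a \<in> I \<Longrightarrow> b \<in> I \<Longrightarrow> k < i \<Longrightarrow> Y a t i = Y b t i" and "k \<le> d" "1 \<le> T"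
    and far: "\<And>a b. a \<in> I \<Longrightarrow> b \<in> I \<Longrightarrow> a \<noteq> b \<Longrightarrow>
      \<exists>t\<in>{1..T}. \<bar>real (count_distinct d (Y a) t) - real (count_distinct d (Y b) t)\<bar> > 2 * \<alpha>"
  shows "real (card I) * (2 / 3) \<le> exp (\<epsilon> * real k)"
proof (cases "I = {}")
  case False
  then obtain b where b: "b \<in> I" by auto
  define G where "G a = {out \<in> space (output_space T). max_error d T (Y a) out \<le> \<alpha>}" for a
  have G: "G a \<in> sets (output_space T)" for a
    unfolding G_def using \<open>1 \<le> T\<close> by (rule accurate_outputs_measurable)
  have Yb: "Y b \<in> input_streams d T" using I b by auto
  interpret prob_space "A (Y b)"
    using alg Yb by (simp add: continual_algorithm_def)
  have sets: "sets (A (Y b)) = sets (output_space T)"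
    using alg Yb by (simp add: continual_algorithm_def)
  have err: "\<bar>out t - real (count_distinct d (Y a) t)\<bar> \<le> \<alpha>"
    if "out \<in> G a" "t \<in> {1..T}" for out a t
  proof -
    have "\<bar>out t - real (count_distinct d (Y a) t)\<bar> \<le> max_error d T (Y a) out"
      unfolding max_error_def using that(2) by (intro Max_ge) auto
    then show ?thesis using that(1) by (simp add: G_def)
  qed
  have disj: "disjoint_family_on G I"
    unfolding disjoint_family_on_def
  proof (intro ballI impI)
    fix a c assume ac: "a \<in> I" "c \<in> I" "a \<noteq> c"
    then obtain t where t: "t \<in> {1..T}"
      "\<bar>real (count_distinct d (Y a) t) - real (count_distinct d (Y c) t)\<bar> > 2 * \<alpha>"
      using far by blast
    have False if "out \<in> G a" "out \<in> G c" for out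
      using err[OF that(1) t(1)] err[OF that(2) t(1)] t(2) by linarith
    then show "G a \<inter> G c = {}" by blast
  qed
  have lower: "2 / 3 \<le> exp (\<epsilon> * real k) * measure (A (Y b)) (G a)" if a: "a \<in> I" for a
  proof -
    have "2 / 3 \<le> measure (A (Y a)) (G a)"
      using acc a I by (auto simp: accurate_on_def G_def)
    also have "\<dots> \<le> exp (\<epsilon> * real k) * measure (A (Y b)) (G a)"
      using item_level_dp_group[OF dp _ _ _ \<open>k \<le> d\<close> G] eq a b I by blast
    finally show ?thesis .
  qed
  have "real (card I) * (2 / 3) \<le> (\<Sum>a\<in>I. exp (\<epsilon> * real k) * measure (A (Y b)) (G a))"
    using sum_mono[of I "\<lambda>_. 2 / 3", OF lower] by simp
  also have "\<dots> = exp (\<epsilon> * real k) * measure (A (Y b)) (\<Union>a\<in>I. G a)"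
    using G sets disj I(1)
    by (subst finite_measure_finite_Union) (auto simp: sum_distrib_left)
  also have "\<dots> \<le> exp (\<epsilon> * real k)"
    by (simp add: mult_left_le)
  finally show ?thesis .
qed simp

text \<open>The binomial coefficient is at least \<open>B = (h / m) ^ m\<close>, and
  \<open>B \<ge> 2\<close>. The factor 2/3 then costs at most two thirds of \<open>ln B\<close>,
  which leaves \<open>ln B / 3 \<le> r\<close>.\<close>

lemma exponent_le_if_binomial_le_exp:
  assumes N: "real (h choose m) * (2 / 3) \<le> exp r" and "1 \<le> m" "2 * m \<le> h"
  shows "real m * ln (real h / real m) \<le> 3 * r"
proof -
  define B where "B = (real h / real m) ^ m"
  have B: "B \<le> real (h choose m)"
    unfolding B_def using assms by (intro binomial_ge_n_over_k_pow_k) auto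
  have hm: "2 \<le> real h / real m"
    using assms by (simp add: field_simps flip: of_nat_mult)
  then have "2 \<le> B"
    using assms(2) self_le_power[of "real h / real m" m] unfolding B_def by linarith
  \<comment> \<open>This is 27/8 < 4, and it gives
    \<open>ln (3 / 2) \<le> 2 / 3 * ln B\<close>.\<close>
  have "(3 / 2) ^ 3 \<le> B ^ 2"
    using power_mono[OF \<open>2 \<le> B\<close>, of 2] by (simp add: power3_eq_cube)
  then have "ln ((3 / 2) ^ 3) \<le> ln (B ^ 2)"
    using \<open>2 \<le> B\<close> by (subst ln_le_cancel_iff) auto
  then have 1: "3 * ln (3 / 2) \<le> 2 * ln B"
    using \<open>2 \<le> B\<close> by (simp add: ln_realpow)
  have "B * (2 / 3) \<le> exp r" using N B by linarith
  then have "ln (B / (3 / 2)) \<le> ln (exp r)"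
    using \<open>2 \<le> B\<close> by (subst ln_le_cancel_iff) auto
  moreover have "ln (B / (3 / 2)) = ln B - ln (3 / 2)"
    using \<open>2 \<le> B\<close> by (intro ln_divide_pos) auto
  moreover have "ln B = real m * ln (real h / real m)"
    unfolding B_def by (rule ln_realpow)
  ultimately show ?thesis using 1 by simp
qed

section \<open>Packing by blocks\<close>

definition block_flips :: "(nat \<Rightarrow> nat \<Rightarrow> nat) \<Rightarrow> nat \<Rightarrow> nat set \<Rightarrow> (nat \<times> nat) set" where
  "block_flips \<tau> k S = (\<lambda>(j, i). (\<tau> j i, i)) ` (S \<times> {1..k})"

text \<open>Item \<open>i \<le> k\<close> flips once in each chosen block \<open>j\<close>, at time \<open>\<tau> j i\<close>, and block \<open>j\<close> ends at time
  \<open>1 + w * j\<close>. The set \<open>P\<close> consists of flips after the last block, which bring the flippancy to the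
  prescribed value.\<close>

locale block_packing =
  fixes d T k w h :: nat and \<tau> :: "nat \<Rightarrow> nat \<Rightarrow> nat" and P :: "(nat \<times> nat) set"
  assumes block: "\<And>j i. j \<in> {1..h} \<Longrightarrow> i \<in> {1..k} \<Longrightarrow>
      1 + w * (j - 1) < \<tau> j i \<and> \<tau> j i \<le> 1 + w * j"
    and pad: "P \<subseteq> {2 + w * h..T} \<times> {1..d}"
    and fits: "1 + w * h \<le> T" and kd: "k \<le> d"
begin

abbreviation flips :: "nat set \<Rightarrow> (nat \<times> nat) set" where
  "flips S \<equiv> block_flips \<tau> k S \<union> P"

text \<open>The blocks are consecutive disjoint intervals of length \<open>w\<close>. Hence, at the
  end of block \<open>j\<close>, where a flip lies inside its block does not matter.\<close>

lemma time_le_iff: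
  assumes "i \<in> {1..k}" "j \<in> {1..h}" "j' \<in> {1..h}"
  shows "\<tau> j' i \<le> 1 + w * j \<longleftrightarrow> j' \<le> j"
proof
  assume "j' \<le> j"
  then have "w * j' \<le> w * j" by simp
  then show "\<tau> j' i \<le> 1 + w * j" using block[OF assms(3,1)] by linarith
next
  assume "\<tau> j' i \<le> 1 + w * j"
  then have "w * (j' - 1) < w * j" using block[OF assms(3,1)] by linarith
  then show "j' \<le> j" by (auto simp: mult_less_cancel1)
qed

lemma time_inj:
  assumes "i \<in> {1..k}" "j \<in> {1..h}" "j' \<in> {1..h}" "\<tau> j i = \<tau> j' i"
  shows "j = j'"
  using time_le_iff[OF assms(1,2,3)] time_le_iff[OF assms(1,3,2)] assms(4)
    block[OF assms(2,1)] block[OF assms(3,1)]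
  by simp

lemma block_flips_subset:
  assumes "S \<subseteq> {1..h}"
  shows "block_flips \<tau> k S \<subseteq> {2..1 + w * h} \<times> {1..d}"
proof -
  have "2 \<le> \<tau> j i \<and> \<tau> j i \<le> 1 + w * h" if "j \<in> S" "i \<in> {1..k}" for j i
  proof -
    have j: "j \<in> {1..h}" using that assms by auto
    then have "w * j \<le> w * h" by simp
    then show ?thesis using block[OF j that(2)] by linarith
  qed
  then show ?thesis using kd by (fastforce simp: block_flips_def)
qed

lemma flips_subset:
  assumes "S \<subseteq> {1..h}"
  shows "flips S \<subseteq> {2..T} \<times> {1..d}"
proof -
  have "{2..1 + w * h} \<subseteq> {2..T}" "{2 + w * h..T} \<subseteq> {2..T}" using fits by auto
  then show ?thesis using block_flips_subset[OF assms] pad by blast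
qed

text \<open>An item flips at different times in different blocks, and the padding starts one step
  after the last block ends, so nothing is counted twice.\<close>

lemma card_flips:
  assumes "S \<subseteq> {1..h}"
  shows "card (flips S) = card S * k + card P"
proof -
  have "inj_on (\<lambda>(j, i). (\<tau> j i, i)) (S \<times> {1..k})"
  proof (rule inj_onI)
    fix p q
    assume pq: "p \<in> S \<times> {1..k}" "q \<in> S \<times> {1..k}"
      "(\<lambda>(j, i). (\<tau> j i, i)) p = (\<lambda>(j, i). (\<tau> j i, i)) q"
    then have snd: "snd p = snd q" and fst: "\<tau> (fst p) (snd p) = \<tau> (fst q) (snd p)"
      by (auto simp: case_prod_beta)
    have "snd p \<in> {1..k}" "fst p \<in> {1..h}" "fst q \<in> {1..h}"
      using pq(1,2) assms by auto
    then have "fst p = fst q" by (rule time_inj[OF _ _ _ fst])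
    with snd show "p = q" by (rule prod_eqI[rotated])
  qed
  then have "card (block_flips \<tau> k S) = card S * k"
    by (simp add: block_flips_def card_image card_cartesian_product)
  moreover have "{2..1 + w * h} \<inter> {2 + w * h..T} = {}" by auto
  then have "block_flips \<tau> k S \<inter> P = {}"
    using block_flips_subset[OF assms] pad by blast
  moreover have "finite (block_flips \<tau> k S)" "finite P"
    using finite_subset[OF block_flips_subset[OF assms]] finite_subset[OF pad] by simp_all
  ultimately show ?thesis by (simp add: card_Un_disjoint)
qed

text \<open>At the end of block \<open>j\<close> each of the first \<open>k\<close> items has
  flipped once per chosen block so far and the padding has not begun. These items are therefore all
  present or all absent, and no other item is present.\<close>

lemma count_distinct_flips:
  assumes S: "S \<subseteq> {1..h}" and j: "j \<in> {1..h}"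
  shows "count_distinct d (flip_stream (flips S)) (1 + w * j) = k * of_bool (odd (card (S \<inter> {1..j})))"
proof -
  have jh: "w * j \<le> w * h" using j by simp
  have early: "(s, i) \<notin> P" if "s \<le> 1 + w * j" for s i
  proof
    assume "(s, i) \<in> P"
    then have "2 + w * h \<le> s" using pad by auto
    with jh that show False by linarith
  qed
  have small: "present (flip_stream (flips S)) (1 + w * j) i = of_bool (odd (card (S \<inter> {1..j})))"
    if i: "i \<in> {1..k}" for i
  proof -
    have mem: "(s, i) \<in> block_flips \<tau> k S \<longleftrightarrow> s \<in> (\<lambda>j'. \<tau> j' i) ` S" for s
      using i by (auto simp: block_flips_def)
    have "{s \<in> {1..1 + w * j}. (s, i) \<in> flips S} = (\<lambda>j'. \<tau> j' i) ` (S \<inter> {1..j})"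
    proof (intro set_eqI iffI)
      fix s assume "s \<in> {s \<in> {1..1 + w * j}. (s, i) \<in> flips S}"
      then obtain j' where "j' \<in> S" "s = \<tau> j' i" "s \<le> 1 + w * j"
        using early mem by auto
      then show "s \<in> (\<lambda>j'. \<tau> j' i) ` (S \<inter> {1..j})"
        using time_le_iff[OF i j, of j'] S by auto
    next
      fix s assume "s \<in> (\<lambda>j'. \<tau> j' i) ` (S \<inter> {1..j})"
      then obtain j' where j': "j' \<in> S" "j' \<le> j" "s = \<tau> j' i" by auto
      then have "j' \<in> {1..h}" using S by auto
      with j' show "s \<in> {s \<in> {1..1 + w * j}. (s, i) \<in> flips S}"
        using time_le_iff[OF i j, of j'] block[OF _ i, of j'] mem by auto
    qed
    moreover have "inj_on (\<lambda>j'. \<tau> j' i) (S \<inter> {1..j})"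
      using time_inj[OF i] S by (intro inj_onI) blast
    ultimately show ?thesis
      by (simp only: present_flip_stream card_image)
  qed
  have large: "present (flip_stream (flips S)) (1 + w * j) i = 0" if "i \<notin> {1..k}" for i
  proof -
    have "{s \<in> {1..1 + w * j}. (s, i) \<in> flips S} = {}"
      using that early by (auto simp: block_flips_def)
    then show ?thesis by (simp only: present_flip_stream) simp
  qed
  have "count_distinct d (flip_stream (flips S)) (1 + w * j) =
      (\<Sum>i=1..k. present (flip_stream (flips S)) (1 + w * j) i)"
    unfolding count_distinct_def using kd large by (intro sum.mono_neutral_right) auto
  also have "\<dots> = (\<Sum>i=1..k. of_bool (odd (card (S \<inter> {1..j}))))"
    using small by (intro sum.cong) auto
  finally show ?thesis by simp
qed

text \<open>Whether \<open>Suc j\<close> belongs to a set is the exclusive or of the parities at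
  \<open>j\<close> and \<open>Suc j\<close>, so the sequence of parities determines the set.\<close>

lemma parity_separates:
  assumes "S \<subseteq> {1..h}" "S' \<subseteq> {1..h}" "S \<noteq> S'"
  shows "\<exists>j\<in>{1..h}. odd (card (S \<inter> {1..j})) \<noteq> odd (card (S' \<inter> {1..j}))"
proof (rule ccontr)
  assume "\<not> ?thesis"
  then have same: "odd (card (S \<inter> {1..j})) = odd (card (S' \<inter> {1..j}))" if "j \<le> h" for j
    using that by (cases "j = 0") auto
  have split: "odd (card (R \<inter> {1..Suc j})) \<longleftrightarrow> (Suc j \<in> R) \<noteq> odd (card (R \<inter> {1..j}))" for R j
  proof -
    have "R \<inter> {1..Suc j} = (if Suc j \<in> R then insert (Suc j) (R \<inter> {1..j}) else R \<inter> {1..j})"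
      by (auto simp: le_Suc_eq)
    then show ?thesis by simp
  qed
  have "i \<in> S \<longleftrightarrow> i \<in> S'" if "i \<in> {1..h}" for i
  proof -
    obtain j where "i = Suc j" using \<open>i \<in> {1..h}\<close> by (cases i) auto
    then show ?thesis using same[of i] same[of j] split[of S j] split[of S' j] that by auto
  qed
  then show False using assms by blast
qed

text \<open>The packing is indexed by all \<open>m\<close>-subsets of the blocks. Two of them differ
  in parity at the end of some block, where the counts are 0 and \<open>k\<close>, further apart
  than \<open>2 * \<alpha>\<close>.\<close>

lemma packing_exponent_le:
  assumes alg: "continual_algorithm d T A" and dp: "item_level_dp d T \<epsilon> A"
    and acc: "accurate_on d T \<alpha> X A"
    and X: "\<And>S. S \<subseteq> {1..h} \<Longrightarrow> card S = m \<Longrightarrow> flip_stream (flips S) \<in> X"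
    and \<alpha>: "2 * \<alpha> < real k" and m: "1 \<le> m" "2 * m \<le> h"
  shows "real m * ln (real h / real m) \<le> 3 * (\<epsilon> * real k)"
proof (rule exponent_le_if_binomial_le_exp[OF _ m])
  define I where "I = {S. S \<subseteq> {1..h} \<and> card S = m}"
  have "real (card I) * (2 / 3) \<le> exp (\<epsilon> * real k)"
  proof (rule packing_bound[OF alg dp acc, where Y = "\<lambda>S. flip_stream (flips S)"])
    show "finite I" by (simp add: I_def)
    show "(\<lambda>S. flip_stream (flips S)) ` I \<subseteq> X" using X by (auto simp: I_def)
    show "(\<lambda>S. flip_stream (flips S)) ` I \<subseteq> input_streams d T"
      using flip_stream_in_likes_streams[OF flips_subset] by (auto simp: I_def likes_streams_def)
    \<comment> \<open>Above item \<open>k\<close> all flips come from the padding \<open>P\<close>,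
      which is common to all \<open>S\<close>.\<close>
    show "flip_stream (flips S) t i = flip_stream (flips S') t i" if "k < i" for S S' t i
      using that by (simp add: flip_stream_def block_flips_def image_iff)
    show "k \<le> d" by (rule kd)
    show "1 \<le> T" using fits by linarith
    show "\<exists>t\<in>{1..T}. \<bar>real (count_distinct d (flip_stream (flips S)) t) -
        real (count_distinct d (flip_stream (flips S')) t)\<bar> > 2 * \<alpha>"
      if SS: "S \<in> I" "S' \<in> I" "S \<noteq> S'" for S S'
    proof -
      have S: "S \<subseteq> {1..h}" "S' \<subseteq> {1..h}" using SS by (auto simp: I_def)
      from parity_separates[OF S SS(3)] obtain j where j: "j \<in> {1..h}"
        "odd (card (S \<inter> {1..j})) \<noteq> odd (card (S' \<inter> {1..j}))" by blast
      have "w * j \<le> w * h" using j by simp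
      then have "1 + w * j \<le> T" using fits by linarith
      then have "1 + w * j \<in> {1..T}" by simp
      moreover have "2 * \<alpha> < \<bar>real (count_distinct d (flip_stream (flips S)) (1 + w * j)) -
        real (count_distinct d (flip_stream (flips S')) (1 + w * j))\<bar>"
        unfolding count_distinct_flips[OF S(1) j(1)] count_distinct_flips[OF S(2) j(1)]
        using j(2) \<alpha> by (cases "odd (card (S \<inter> {1..j}))") (simp_all del: One_nat_def)
      ultimately show ?thesis by blast
    qed
  qed
  then show "real (h choose m) * (2 / 3) \<le> exp (\<epsilon> * real k)"
    using n_subsets[of "{1..h}" m] by (simp add: I_def)
qed

end

section \<open>Choice of the parameters\<close>

text \<open>All \<open>k\<close> items flip in the same step, so blocks have length 1. Half of the
  time goes to blocks and the rest to padding. The factor 8 on the right of the last hypothesis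
  leaves room for a bound stated in some \<open>L \<le> 8 * K\<close>.\<close>

lemma multi_packing_contradiction:
  assumes T: "T > 4" and eps: "\<epsilon> > 0" and K: "4 * K \<le> d * T"
    and alg: "continual_algorithm d T A" and dp: "item_level_dp d T \<epsilon> A"
    and acc: "accurate_on d T \<alpha> (likes_streams d T K) A"
    and k: "1 \<le> k" "k \<le> d" "k \<le> K" and \<alpha>: "2 * \<alpha> < real k"
    and kT: "64 * real k * \<epsilon> \<le> real T"
    and kK: "4096 * (real k)\<^sup>2 * \<epsilon> \<le> 8 * real K * max (ln (real T / real K)) 1"
  shows False
proof -
  define h where "h = T div 2"
  define m where "m = min (K div k) (h div 2)"
  have "1 \<le> K div k" using k by (simp add: Suc_le_eq div_greater_zero_iff)
  moreover have "1 \<le> h div 2" using T by (simp add: h_def)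
  ultimately have m: "1 \<le> m" "2 * m \<le> h" by (auto simp: m_def)
  have mk: "m * k \<le> K"
  proof -
    have "m \<le> K div k" by (simp add: m_def)
    then have "m * k \<le> (K div k) * k" by (rule mult_le_mono1)
    also have "\<dots> \<le> K" by simp
    finally show ?thesis .
  qed
  have "K - m * k \<le> card ({2 + 1 * h..T} \<times> {1..d})"
  proof -
    \<comment> \<open>The padding has \<open>T - 1 - h\<close> steps with \<open>d\<close> flips
      available in each; for \<open>T > 4\<close> this is at least a quarter of
      \<open>d * T\<close>, hence at least \<open>K\<close>.\<close>
    have "T \<le> 4 * (T - 1 - h)" using T by (simp add: h_def)
    then have "d * T \<le> d * (4 * (T - 1 - h))" by (rule mult_le_mono2)
    with K have "4 * K \<le> d * (4 * (T - 1 - h))" by (rule order_trans)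
    then have "4 * K \<le> 4 * (d * (T - 1 - h))" by (simp only: mult_ac)
    then show ?thesis by (simp add: card_cartesian_product mult.commute)
  qed
  then obtain P where P: "P \<subseteq> {2 + 1 * h..T} \<times> {1..d}" "card P = K - m * k"
    by (rule obtain_subset_with_card_n)
  interpret block_packing d T k 1 h "\<lambda>j i. 1 + j" P
    using P(1) k T by unfold_locales (auto simp: h_def)
  have "flip_stream (flips S) \<in> likes_streams d T K" if S: "S \<subseteq> {1..h}" "card S = m" for S
    using flip_stream_in_likes_streams[OF flips_subset[OF S(1)]] card_flips[OF S(1)] P(2) S(2) mk
    by simp
  then have main: "real m * ln (real h / real m) \<le> 3 * (\<epsilon> * real k)"
    by (intro packing_exponent_le[OF alg dp acc _ \<alpha> m])
  have hm2: "2 \<le> real h / real m"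
    using m by (simp add: field_simps flip: of_nat_mult)
  then have "ln 2 \<le> ln (real h / real m)" by simp
  then have half: "1 / 2 \<le> ln (real h / real m)"
    using ln_2_less_1 ln2_ge_two_thirds by linarith
  \<comment> \<open>If the number of blocks limits \<open>m\<close>, then \<open>m\<close> is of
    order \<open>T\<close> and the bound on \<open>k * \<epsilon>\<close> by \<open>T\<close> fails.
    If the flippancy limits \<open>m\<close>, then \<open>m * k\<close> is at least
    \<open>K / 2\<close> and the quadratic bound on \<open>k\<close> fails.\<close>
  show False
  proof (cases "h div 2 \<le> K div k")
    case True
    then have "m = T div 4" by (simp add: m_def h_def flip: div_mult2_eq)
    then have "T \<le> 8 * m" using T by presburger
    then have "real T \<le> 8 * real m" by linarith
    moreover have "real m * (1 / 2) \<le> real m * ln (real h / real m)"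
      using half by (intro mult_left_mono) auto
    ultimately have "real T / 16 \<le> 3 * (\<epsilon> * real k)" using main by linarith
    then have "real T \<le> 48 * (k * \<epsilon>)" by (simp add: mult.commute)
    moreover have "0 < k * \<epsilon>" using k eps by simp
    ultimately show False using kT by (simp add: mult.assoc)
  next
    case False
    then have md: "m = K div k" by (simp add: m_def)
    define M where "M = max (ln (real T / real K)) 1"
    have Kpos: "0 < real K" using k by linarith
    have "K < (m + 1) * k"
      using k md dividend_less_div_times[of k K] by simp
    also have "\<dots> \<le> (2 * m) * k" using m by (intro mult_le_mono1) simp
    finally have "real K \<le> real (2 * m * k)" by (simp only: of_nat_le_iff)
    then have K2: "real K \<le> 2 * real m * real k" by simp
    \<comment> \<open>For \<open>M \<le> 2\<close> the bound 1/2 suffices. Otherwise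
      \<open>y = T / K\<close> exceeds \<open>exp 2 > 7\<close>, so
      \<open>h / m \<ge> 2 / 5 * y \<ge> sqrt y\<close> (the last step needs
      \<open>y \<ge> 25 / 4\<close>), and \<open>ln (sqrt y) = M / 2\<close>.\<close>
    have "M / 4 \<le> ln (real h / real m)"
    proof (cases "M \<le> 2")
      case True
      then show ?thesis using half by linarith
    next
      case False
      define y where "y = real T / real K"
      have M: "M = ln y" "2 < ln y" using False by (auto simp: M_def y_def)
      have y0: "0 < y" using T Kpos by (simp add: y_def)
      have "exp 2 < y" using M(2) y0 by (metis exp_less_cancel_iff exp_ln)
      moreover have "(7::real) \<le> exp 2"
      proof -
        have "(2.7::real) \<le> exp 1" using e_approx_32 by (simp add: abs_if split: if_splits)
        then have "(2.7::real) ^ 2 \<le> exp 1 ^ 2" by (intro power_mono) auto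
        then show ?thesis by (simp add: power2_eq_square flip: exp_add)
      qed
      ultimately have y: "7 < y" by linarith
      \<comment> \<open>The constant 2/5 is attained at \<open>T = 5\<close>, where
        \<open>h = 2\<close>.\<close>
      have "2 * real T \<le> 5 * real h"
      proof -
        have "2 * T \<le> 5 * h" using T by (simp add: h_def)
        then show ?thesis by linarith
      qed
      have "real m * real k \<le> real K" using mk by (simp flip: of_nat_mult)
      moreover have "real m \<le> real m * real k" using mult_left_mono[of 1 "real k" "real m"] k by simp
      ultimately have mK: "real m \<le> real K" by linarith
      have "2 / 5 * y = (2 * real T / 5) / real K" by (simp add: y_def)
      also have "\<dots> \<le> real h / real m"
        using \<open>2 * real T \<le> 5 * real h\<close> mK m by (intro frac_le) auto
      finally have "2 / 5 * y \<le> real h / real m" .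
      moreover have "sqrt y \<le> 2 / 5 * y"
      proof (rule real_le_lsqrt)
        have "y * 1 \<le> y * (4 / 25 * y)" using y by (intro mult_left_mono) auto
        then show "y \<le> (2 / 5 * y)\<^sup>2" by (simp add: power2_eq_square)
      qed (use y in auto)
      ultimately have "sqrt y \<le> real h / real m" by linarith
      then have "ln (sqrt y) \<le> ln (real h / real m)"
        using y by (intro ln_mono) auto
      then show ?thesis using M y by (simp add: ln_sqrt)
    qed
    then have "real m * (M / 4) \<le> 3 * (\<epsilon> * real k)"
      using main by (meson mult_left_mono of_nat_0_le_iff order_trans)
    then have "real m * M \<le> 12 * (\<epsilon> * real k)" by simp
    then have "(2 * real k) * (real m * M) \<le> (2 * real k) * (12 * (\<epsilon> * real k))"
      by (intro mult_left_mono) auto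
    moreover have "real K * M \<le> (2 * real m * real k) * M"
      using K2 by (intro mult_right_mono) (auto simp: M_def)
    \<comment> \<open>The packing gives \<open>K * M \<le> 24 * k^2 * \<epsilon>\<close>, whereas
      the hypothesis gives \<open>512 * k^2 * \<epsilon> \<le> K * M\<close>.\<close>
    ultimately have "real K * M \<le> 24 * ((real k)\<^sup>2 * \<epsilon>)"
      by (simp add: power2_eq_square mult_ac)
    moreover have "4096 * ((real k)\<^sup>2 * \<epsilon>) \<le> 8 * (real K * M)"
      using kK by (simp add: M_def mult_ac)
    moreover have "0 < (real k)\<^sup>2 * \<epsilon>" using k eps by simp
    ultimately show False by linarith
  qed
qed

text \<open>A block now takes \<open>k\<close> steps, with item \<open>i\<close> flipping at the
  \<open>i\<close>-th of them, so only about \<open>T / (2 * k)\<close> blocks fit into half of the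
  time. The condition \<open>8 * K \<le> T\<close> ensures \<open>4 * m \<le> h\<close> and leaves
  room for the padding.\<close>

lemma single_packing_contradiction:
  assumes eps: "\<epsilon> > 0" and K: "8 * K \<le> T"
    and alg: "continual_algorithm d T A" and dp: "item_level_dp d T \<epsilon> A"
    and acc: "accurate_on d T \<alpha> (single_likes_streams d T K) A"
    and k: "1 \<le> k" "k \<le> d" "k \<le> K" and \<alpha>: "2 * \<alpha> < real k"
    and kK: "4096 * (real k)\<^sup>2 * \<epsilon> \<le> real K * ln (real T / real K)"
  shows False
proof -
  define h where "h = T div (2 * k)"
  define m where "m = K div k"
  have m1: "1 \<le> m" using k by (simp add: Suc_le_eq div_greater_zero_iff m_def)
  have mk: "m * k \<le> K" by (simp add: m_def)
  have "K < (m + 1) * k"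
    using k dividend_less_div_times[of k K] by (simp add: m_def)
  also have "\<dots> \<le> (2 * m) * k" using m1 by (intro mult_le_mono1) simp
  finally have "real K \<le> real (2 * m * k)" by (simp only: of_nat_le_iff)
  then have K2: "real K \<le> 2 * real m * real k" by simp
  have hk: "2 * (k * h) \<le> T" using times_div_less_eq_dividend[of "2 * k" T] by (simp add: h_def mult_ac)
  have "4 * m \<le> h"
  proof -
    have "(4 * m) * (2 * k) \<le> T" using mk K by (simp add: mult_ac)
    then show ?thesis using k by (simp add: h_def less_eq_div_iff_mult_less_eq)
  qed
  then have m2: "2 * m \<le> h" by simp
  have "T < (h + 1) * (2 * k)"
    using k dividend_less_div_times[of "2 * k" T] by (simp add: h_def)
  also have "\<dots> \<le> (2 * h) * (2 * k)" using m1 m2 by (intro mult_le_mono1) simp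
  finally have "real T \<le> real (2 * h * (2 * k))" by (simp only: of_nat_le_iff)
  then have T4: "real T \<le> 4 * real h * real k" by simp
  \<comment> \<open>The missing flips are all given to item 1, at the last steps of the stream, one
    per step.\<close>
  define P where "P = {T - (K - m * k) + 1..T} \<times> {1::nat}"
  have Pcard: "card P = K - m * k" using K by (simp add: P_def)
  define \<tau> where "\<tau> j i = 1 + k * (j - 1) + i" for j i
  have fits: "1 + k * h + K \<le> T" using hk K k by linarith
  interpret block_packing d T k k h \<tau> P
  proof unfold_locales
    show "1 + k * (j - 1) < \<tau> j i \<and> \<tau> j i \<le> 1 + k * j" if "j \<in> {1..h}" "i \<in> {1..k}" for j i
    proof -
      obtain j' where "j = Suc j'" using \<open>j \<in> {1..h}\<close> by (cases j) auto
      then show ?thesis using that by (simp add: \<tau>_def)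
    qed
    show "P \<subseteq> {2 + k * h..T} \<times> {1..d}"
      using fits k by (auto simp: P_def)
    show "1 + k * h \<le> T" using fits by linarith
    show "k \<le> d" by (rule k(2))
  qed
  have "flip_stream (flips S) \<in> single_likes_streams d T K" if S: "S \<subseteq> {1..h}" "card S = m" for S
  proof -
    have "i = i'" if "(t, i) \<in> flips S" "(t, i') \<in> flips S" for t i i'
    proof -
      consider "(t, i) \<in> block_flips \<tau> k S" "(t, i') \<in> block_flips \<tau> k S"
        | "(t, i) \<in> P" "(t, i') \<in> P"
        | "t \<in> {2..1 + k * h}" "t \<in> {2 + k * h..T}"
        using \<open>(t, i) \<in> flips S\<close> \<open>(t, i') \<in> flips S\<close> block_flips_subset[OF S(1)] pad by blast
      then show ?thesis
      proof cases
        case 1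
        \<comment> \<open>Blocks start at time 2 and have length \<open>k\<close>, so the residue of
          \<open>t - 2\<close> modulo \<open>k\<close> identifies the only item that can flip at
          time \<open>t\<close>.\<close>
        have mod: "i - 1 = (t - 2) mod k \<and> 1 \<le> i" if mem: "(t, i) \<in> block_flips \<tau> k S" for i
        proof -
          obtain j where "t = \<tau> j i" "i \<in> {1..k}"
            using mem by (auto simp: block_flips_def)
          then have t: "t - 2 = (i - 1) + k * (j - 1)" and i: "i - 1 < k" "1 \<le> i"
            by (auto simp: \<tau>_def)
          show ?thesis unfolding t mod_mult_self2 using i by simp
        qed
        show ?thesis using mod[OF 1(1)] mod[OF 1(2)] by linarith
      next
        case 2
        then show ?thesis by (simp add: P_def)
      next
        case 3
        then show ?thesis by simp
      qed
    qed
    then have "single_update d T (flip_stream (flips S))"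
      by (rule single_update_flip_stream)
    then show ?thesis
      using flip_stream_in_likes_streams[OF flips_subset[OF S(1)]] card_flips[OF S(1)] Pcard S(2) mk
      by (simp add: single_likes_streams_def)
  qed
  then have main: "real m * ln (real h / real m) \<le> 3 * (\<epsilon> * real k)"
    by (intro packing_exponent_le[OF alg dp acc _ \<alpha> m1 m2])
  define y where "y = real T / real K"
  have Kpos: "0 < real K" using k by linarith
  have y: "8 \<le> y" using K Kpos by (simp add: y_def field_simps flip: of_nat_mult)
  have "y / 4 \<le> real h / real m"
  proof -
    have "y / 4 = (real T / 4) / real K" by (simp add: y_def)
    also have "\<dots> \<le> (real h * real k) / (real m * real k)"
    proof (rule frac_le)
      show "real m * real k \<le> real K" using mk by (simp flip: of_nat_mult)
      show "0 < real m * real k" using m1 k by simp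
    qed (use T4 in auto)
    finally show ?thesis using k by simp
  qed
  then have "ln (y / 4) \<le> ln (real h / real m)"
    using y by (intro ln_mono) auto
  \<comment> \<open>Since \<open>y \<ge> 8\<close>, \<open>y^2 \<ge> 64 = 4^3\<close>, so
    \<open>ln 4\<close> is at most two thirds of \<open>ln y\<close>.\<close>
  moreover have "ln y / 3 \<le> ln (y / 4)"
  proof -
    have "(4::real) ^ 3 \<le> y ^ 2" using power_mono[OF y, of 2] by simp
    then have "ln ((4::real) ^ 3) \<le> ln (y ^ 2)" using y by (subst ln_le_cancel_iff) auto
    then have "3 * ln 4 \<le> 2 * ln y" unfolding ln_realpow by simp
    moreover have "ln (y / 4) = ln y - ln 4" using y by (intro ln_divide_pos) auto
    ultimately show ?thesis by linarith
  qed
  ultimately have "real m * (ln y / 3) \<le> 3 * (\<epsilon> * real k)"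
    using main by (meson mult_left_mono of_nat_0_le_iff order_trans)
  then have "real m * ln y \<le> 9 * (\<epsilon> * real k)" by simp
  then have "(2 * real k) * (real m * ln y) \<le> (2 * real k) * (9 * (\<epsilon> * real k))"
    by (intro mult_left_mono) auto
  moreover have "real K * ln y \<le> (2 * real m * real k) * ln y"
    using K2 y by (intro mult_right_mono) auto
  ultimately have "real K * ln y \<le> 18 * ((real k)\<^sup>2 * \<epsilon>)"
    by (simp add: power2_eq_square mult_ac)
  moreover have "4096 * ((real k)\<^sup>2 * \<epsilon>) \<le> real K * ln y"
    using kK by (simp add: y_def mult_ac)
  moreover have "0 < (real k)\<^sup>2 * \<epsilon>" using k eps by simp
  ultimately show False by linarith
qed

section \<open>From refuting each number of items to the asymptotic bound\<close>

text \<open>Take \<open>k\<close> as the integer part of \<open>g / 64\<close>. The threshold 64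
  makes \<open>k \<ge> 1\<close>, so rounding loses at most a factor 2, and
  \<open>\<alpha> < g / 256\<close> gives \<open>2 * \<alpha> < g / 128 < k\<close>.\<close>

lemma Omega_bound_by_contradiction:
  assumes "\<And>k. 1 \<le> k \<Longrightarrow> 64 * real k \<le> g \<Longrightarrow> 2 * \<alpha> < real k \<Longrightarrow> False"
  shows "Omega_bound (1 / 256) 64 \<alpha> g"
proof (unfold Omega_bound_def, intro impI, rule ccontr)
  assume g: "64 \<le> g" and \<alpha>: "\<not> 1 / 256 * g \<le> \<alpha>"
  define k where "k = nat \<lfloor>g / 64\<rfloor>"
  have k: "real k = of_int \<lfloor>g / 64\<rfloor>" using g by (simp add: k_def)
  have "1 \<le> \<lfloor>g / 64\<rfloor>" using g by simp
  then have "1 \<le> real k" by (simp add: k)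
  moreover have "real k \<le> g / 64" "g / 64 < real k + 1" unfolding k by linarith+
  ultimately show False using assms[of k] \<alpha> by simp
qed

text \<open>\<open>sqrt\<close> is an odd function on all reals, so the positive lower bound
  \<open>x\<close> forces \<open>z\<close> to be positive.\<close>

lemma power2_le_if_le_sqrt:
  assumes "0 < x" "x \<le> sqrt z"
  shows "x\<^sup>2 \<le> z"
proof -
  have "0 < z" using assms by (meson less_le_trans real_sqrt_gt_0_iff)
  then show ?thesis using power_mono[OF assms(2), of 2] assms(1) by simp
qed

text \<open>The parameter \<open>L\<close> covers both forms of the bound: the given
  \<open>L\<close>, and \<open>L = K\<close>. Passing from \<open>L\<close> to \<open>K\<close>
  costs a factor 8 in front and only increases the logarithm.\<close>

lemma Omega_bound_multi:
  assumes "T > 4" "\<epsilon> > 0" "4 * K \<le> d * T"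
    and alg: "continual_algorithm d T A" and dp: "item_level_dp d T \<epsilon> A"
    and acc: "accurate_on d T \<alpha> (likes_streams d T K) A"
    and L: "K \<le> L" "L \<le> 8 * K"
  shows "Omega_bound (1 / 256) 64 \<alpha> (multi_bound d T \<epsilon> L)"
proof (rule Omega_bound_by_contradiction)
  fix k :: nat
  assume k: "1 \<le> k" and b: "64 * real k \<le> multi_bound d T \<epsilon> L" and \<alpha>: "2 * \<alpha> < real k"
  have b1: "64 * real k \<le> real d" "64 * real k \<le> real L" "64 * real k \<le> real T / \<epsilon>"
    and b2: "64 * real k \<le> sqrt (real L / \<epsilon> * max (ln (real T / real L)) 1)"
    using b by (auto simp: multi_bound_def)
  have "k \<le> d" using b1(1) by linarith
  moreover have "k \<le> K" using b1(2) L by linarith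
  moreover have "64 * real k * \<epsilon> \<le> real T"
    using b1(3) assms(2) by (simp add: pos_le_divide_eq)
  moreover have "4096 * (real k)\<^sup>2 * \<epsilon> \<le> 8 * real K * max (ln (real T / real K)) 1"
  proof -
    have "(64 * real k)\<^sup>2 \<le> real L / \<epsilon> * max (ln (real T / real L)) 1"
      using k b2 by (intro power2_le_if_le_sqrt) auto
    then have "4096 * (real k)\<^sup>2 * \<epsilon> \<le> real L * max (ln (real T / real L)) 1"
      using assms(2) by (simp add: power_mult_distrib field_simps)
    also have "\<dots> \<le> 8 * real K * max (ln (real T / real K)) 1"
    proof (rule mult_mono)
      have "0 < real K" using \<open>k \<le> K\<close> k by linarith
      then have "ln (real T / real L) \<le> ln (real T / real K)"
        using L(1) assms(1) by (subst ln_le_cancel_iff) (auto intro!: divide_left_mono)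
      then show "max (ln (real T / real L)) 1 \<le> max (ln (real T / real K)) 1" by auto
    qed (use L in auto)
    finally show ?thesis .
  qed
  ultimately show False
    using multi_packing_contradiction[OF assms(1-3) alg dp acc k] \<alpha> by blast
qed

lemma Omega_bound_single:
  assumes "\<epsilon> > 0" "8 * K \<le> T"
    and alg: "continual_algorithm d T A" and dp: "item_level_dp d T \<epsilon> A"
    and acc: "accurate_on d T \<alpha> (single_likes_streams d T K) A"
  shows "Omega_bound (1 / 256) 64 \<alpha> (single_bound d T \<epsilon> K)"
proof (rule Omega_bound_by_contradiction)
  fix k :: nat
  assume k: "1 \<le> k" and b: "64 * real k \<le> single_bound d T \<epsilon> K" and \<alpha>: "2 * \<alpha> < real k"
  have b1: "64 * real k \<le> real d" "64 * real k \<le> real K"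
    and b2: "64 * real k \<le> sqrt (real K / \<epsilon> * ln (real T / real K))"
    using b by (auto simp: single_bound_def)
  have "(64 * real k)\<^sup>2 \<le> real K / \<epsilon> * ln (real T / real K)"
    using k b2 by (intro power2_le_if_le_sqrt) auto
  then have "4096 * (real k)\<^sup>2 * \<epsilon> \<le> real K * ln (real T / real K)"
    using assms(1) by (simp add: power_mult_distrib field_simps)
  moreover have "k \<le> d" "k \<le> K" using b1 by linarith+
  ultimately show False
    using single_packing_contradiction[OF assms(1,2) alg dp acc k] \<alpha> by blast
qed

section \<open>Admissible flippancies and streams attaining them\<close>

lemma multi_flippancy_exists:
  assumes T: "T > 4" and L: "L \<ge> 8" "L \<le> d * T"
  obtains K where "4 * K \<le> d * T" "K \<le> L" "L \<le> 8 * K"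
    "min (3 * real L / 8) (real T / 4 - 1) \<le> real K"
proof -
  define N where "N = d * T"
  \<comment> \<open>This is 3L/8 rounded up, capped by dT/4 rounded down. If the cap applies, then
    \<open>d \<ge> 1\<close> gives \<open>K \<ge> T / 4 - 1\<close>, and \<open>L \<ge> 8\<close>
    keeps \<open>L \<le> 8 * K\<close> despite the rounding.\<close>
  define K where "K = min ((3 * L + 7) div 8) (N div 4)"
  have "4 * K \<le> N" "K \<le> L" "L \<le> 8 * K"
    using L unfolding K_def N_def[symmetric] by (auto simp: min_def)
  moreover have "T \<le> N" using L by (cases d) (auto simp: N_def)
  then have "3 * L \<le> 8 * K \<or> T \<le> 4 * K + 4"
    unfolding K_def by (auto simp: min_def)
  then have "min (3 * real L / 8) (real T / 4 - 1) \<le> real K" by linarith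
  ultimately show ?thesis using that by (simp add: N_def)
qed

text \<open>Supplies the stream \<open>x\<close> of the first claim, so that accuracy is demanded on
  a nonempty class.\<close>

lemma likes_stream_exists:
  assumes "T > 4" "4 * K \<le> d * T"
  shows "\<exists>x. x \<in> likes_streams d T K"
proof -
  have "d * T \<le> d * (4 * (T - 1))" using assms(1) by (intro mult_le_mono2) simp
  with assms(2) have "4 * K \<le> d * (4 * (T - 1))" by (rule order_trans)
  then have "4 * K \<le> 4 * (d * (T - 1))" by (simp only: mult_ac)
  then have "K \<le> card ({2..T} \<times> {1..d})" by (simp add: card_cartesian_product mult.commute)
  then obtain F where "F \<subseteq> {2..T} \<times> {1..d}" "card F = K"
    by (rule obtain_subset_with_card_n)
  then show ?thesis using flip_stream_in_likes_streams by blast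
qed

lemma single_likes_stream_exists:
  assumes "1 \<le> d" "K < T"
  shows "\<exists>x. x \<in> single_likes_streams d T K"
proof -
  \<comment> \<open>Item 1 alone flips, at \<open>K\<close> consecutive steps starting at time
    2.\<close>
  let ?F = "{2..K + 1} \<times> {1::nat}"
  have "flip_stream ?F \<in> likes_streams d T (card ?F)"
    using assms by (intro flip_stream_in_likes_streams) auto
  moreover have "single_update d T (flip_stream ?F)"
    by (rule single_update_flip_stream) auto
  ultimately show ?thesis by (auto simp: single_likes_streams_def)
qed

theorem theorem5p1:
  shows
   "(\<exists>c>0. \<exists>g0. \<forall>(d::nat) (T::nat) (\<epsilon>::real) (L::nat).
       T > 4 \<longrightarrow> \<epsilon> > 0 \<longrightarrow> L \<ge> 8 \<longrightarrow> L \<le> d * T \<longrightarrow>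
       (\<exists>K. \<exists>x \<in> input_streams d T.
          likes_valid d T x \<and> total_flippancy d T x = K \<and>
          min (3 * real L / 8) (real T / 4 - 1) \<le> real K \<and>
          real K \<le> min (real L) (real d * real T / 4) \<and>
          (\<forall>A \<alpha>. continual_algorithm d T A \<longrightarrow> item_level_dp d T \<epsilon> A \<longrightarrow>
             accurate_on d T \<alpha> (likes_streams d T K) A \<longrightarrow>
             Omega_bound c g0 \<alpha> (multi_bound d T \<epsilon> L) \<and>
             Omega_bound c g0 \<alpha> (multi_bound d T \<epsilon> K))))
    \<and>
    (\<exists>c>0. \<exists>g0. \<forall>(d::nat) (T::nat) (\<epsilon>::real) (L::nat).
       T > 4 \<longrightarrow> \<epsilon> > 0 \<longrightarrow> d \<ge> 1 \<longrightarrow> L \<ge> 8 \<longrightarrow> L \<le> T \<longrightarrow>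
       (\<exists>K. \<exists>x \<in> input_streams d T.
          likes_valid d T x \<and> single_update d T x \<and> total_flippancy d T x = K \<and>
          real L / 16 \<le> real K \<and>
          real K \<le> min (real L) (real T / 4) \<and>
          (\<forall>A \<alpha>. continual_algorithm d T A \<longrightarrow> item_level_dp d T \<epsilon> A \<longrightarrow>
             accurate_on d T \<alpha> (single_likes_streams d T K) A \<longrightarrow>
             Omega_bound c g0 \<alpha> (single_bound d T \<epsilon> K))))"
proof (rule conjI; rule exI[of _ "1 / 256"]; rule conjI; (rule exI[of _ 64])?)
  show "(0::real) < 1 / 256" "(0::real) < 1 / 256" by simp_all
  show "\<forall>(d::nat) (T::nat) (\<epsilon>::real) (L::nat).
       T > 4 \<longrightarrow> \<epsilon> > 0 \<longrightarrow> L \<ge> 8 \<longrightarrow> L \<le> d * T \<longrightarrow>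
       (\<exists>K. \<exists>x \<in> input_streams d T.
          likes_valid d T x \<and> total_flippancy d T x = K \<and>
          min (3 * real L / 8) (real T / 4 - 1) \<le> real K \<and>
          real K \<le> min (real L) (real d * real T / 4) \<and>
          (\<forall>A \<alpha>. continual_algorithm d T A \<longrightarrow> item_level_dp d T \<epsilon> A \<longrightarrow>
             accurate_on d T \<alpha> (likes_streams d T K) A \<longrightarrow>
             Omega_bound (1 / 256) 64 \<alpha> (multi_bound d T \<epsilon> L) \<and>
             Omega_bound (1 / 256) 64 \<alpha> (multi_bound d T \<epsilon> K)))"
  proof (intro allI impI)
    fix d T L :: nat and \<epsilon> :: real
    assume T: "T > 4" and eps: "\<epsilon> > 0" and L: "L \<ge> 8" "L \<le> d * T"
    obtain K where K: "4 * K \<le> d * T" "K \<le> L" "L \<le> 8 * K"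
      and K': "min (3 * real L / 8) (real T / 4 - 1) \<le> real K"
      using multi_flippancy_exists[OF T L] .
    obtain x where x: "x \<in> likes_streams d T K"
      using likes_stream_exists[OF T K(1)] by blast
    have "4 * real K \<le> real d * real T"
      using K(1) by (simp flip: of_nat_mult)
    then have "real K \<le> min (real L) (real d * real T / 4)"
      using K(2) by simp
    then show "\<exists>K. \<exists>x \<in> input_streams d T.
          likes_valid d T x \<and> total_flippancy d T x = K \<and>
          min (3 * real L / 8) (real T / 4 - 1) \<le> real K \<and>
          real K \<le> min (real L) (real d * real T / 4) \<and>
          (\<forall>A \<alpha>. continual_algorithm d T A \<longrightarrow> item_level_dp d T \<epsilon> A \<longrightarrow>
             accurate_on d T \<alpha> (likes_streams d T K) A \<longrightarrow>
             Omega_bound (1 / 256) 64 \<alpha> (multi_bound d T \<epsilon> L) \<and>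
             Omega_bound (1 / 256) 64 \<alpha> (multi_bound d T \<epsilon> K))"
      \<comment> \<open>\<open>Omega_bound_multi\<close> serves twice: for the bound in
        \<open>L\<close>, and for the bound in \<open>K\<close> with \<open>K\<close> in the place
        of \<open>L\<close>.\<close>
      using x K' Omega_bound_multi[OF T eps K(1)] K(2,3)
      by (intro exI[of _ K] bexI[of _ x]) (simp_all add: likes_streams_def)
  qed
  show "\<forall>(d::nat) (T::nat) (\<epsilon>::real) (L::nat).
       T > 4 \<longrightarrow> \<epsilon> > 0 \<longrightarrow> d \<ge> 1 \<longrightarrow> L \<ge> 8 \<longrightarrow> L \<le> T \<longrightarrow>
       (\<exists>K. \<exists>x \<in> input_streams d T.
          likes_valid d T x \<and> single_update d T x \<and> total_flippancy d T x = K \<and>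
          real L / 16 \<le> real K \<and>
          real K \<le> min (real L) (real T / 4) \<and>
          (\<forall>A \<alpha>. continual_algorithm d T A \<longrightarrow> item_level_dp d T \<epsilon> A \<longrightarrow>
             accurate_on d T \<alpha> (single_likes_streams d T K) A \<longrightarrow>
             Omega_bound (1 / 256) 64 \<alpha> (single_bound d T \<epsilon> K)))"
  proof (intro allI impI)
    fix d T L :: nat and \<epsilon> :: real
    assume eps: "\<epsilon> > 0" and d: "d \<ge> 1" and L: "L \<ge> 8" "L \<le> T"
    \<comment> \<open>L/16 rounded up; \<open>L \<ge> 8\<close> makes it at most L/8, as the packing
      with single updates requires.\<close>
    define K where "K = (L + 15) div 16"
    have "16 * K \<le> L + 15" by (simp add: K_def)
    moreover have "L \<le> 16 * K" by (simp add: K_def)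
    ultimately have K: "L \<le> 16 * K" "8 * K \<le> L" using L by presburger+
    then have KT: "8 * K \<le> T" "K < T" using L by auto
    obtain x where x: "x \<in> single_likes_streams d T K"
      using single_likes_stream_exists[OF d KT(2)] by blast
    have "real L / 16 \<le> real K" "real K \<le> min (real L) (real T / 4)"
      using K KT by simp_all
    then show "\<exists>K. \<exists>x \<in> input_streams d T.
          likes_valid d T x \<and> single_update d T x \<and> total_flippancy d T x = K \<and>
          real L / 16 \<le> real K \<and>
          real K \<le> min (real L) (real T / 4) \<and>
          (\<forall>A \<alpha>. continual_algorithm d T A \<longrightarrow> item_level_dp d T \<epsilon> A \<longrightarrow>
             accurate_on d T \<alpha> (single_likes_streams d T K) A \<longrightarrow>
             Omega_bound (1 / 256) 64 \<alpha> (single_bound d T \<epsilon> K))"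
      using x Omega_bound_single[OF eps KT(1)]
      by (intro exI[of _ K] bexI[of _ x]) (simp_all add: likes_streams_def single_likes_streams_def)
  qed
qed

end
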